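(* Let the non-intersecting and non-parallel linear varieties $$V_{\vec b} := \{\vec b + B\vec u : \vec u \in \mathbb{R}^{l_1}\}, \qquad V_{\vec c} := \{\vec c - C\vec v : \vec v \in \mathbb{R}^{l_2}\}$$ be given, where $\vec b$ and $\vec c$ are given vectors in $\mathbb{R}^m$ and $B$ and $C$ are real matrices of type $m\times l_1$ and $m\times l_2$, respectively. Then the best approximation points $\vec b^{*} = \vec b + B\vec u^{*}$ and $\vec c^{*} = \vec c - C\vec v^{*}$ are obtained through $$\begin{bmatrix} \vec u^{*} \\ \vec v^{*}\end{bmatrix} = \begin{bmatrix} (I + HH^T)^{-1}(B^\dagger - B^\dagger C G^\dagger) \\ H^T (I + HH^T)^{-1}(B^\dagger - B^\dagger C G^\dagger) + G^\dagger \end{bmatrix} (\vec c - \vec b),$$ with $G = (I - BB^\dagger)C$ and $H = B^\dagger C (I - G^\dagger G)$, where $\vec u^{*}\in\mathbb{R}^{l_1}$ and $\vec v^{*}\in\mathbb{R}^{l_2}$.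
   Context: $\|\cdot\|$ is the Euclidean norm on $\mathbb{R}^m$, $T$ denotes matrix transposition, $I$ denotes the identity matrix of the appropriate size, and $\dagger$ denotes the Moore-Penrose inverse. The Euclidean distance $d(V_{\vec b},V_{\vec c})$ is the minimum of $\|\vec b + B\vec u - \vec c + C\vec v\|$ over $\vec u\in\mathbb{R}^{l_1}$, $\vec v\in\mathbb{R}^{l_2}$. The best approximation pair of the linear varieties $V_{\vec b}$ and $V_{\vec c}$ is the pair $(\vec b^{*},\vec c^{*})\in V_{\vec b}\times V_{\vec c}$ such that $\|\vec b^{*}-\vec c^{*}\| = d(V_{\vec b},V_{\vec c})$; its two members are the best approximation points. The Moore-Penrose inverse $M^\dagger$ of a real matrix $M$ is the unique matrix satisfying $MM^\dagger M = M$, $M^\dagger M M^\dagger = M^\dagger$, $(MM^\dagger)^T = MM^\dagger$ and $(M^\dagger M)^T = M^\dagger M$. *)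

theory Defs
  imports "HOL-Analysis.Analysis"
begin

text \<open>The four Penrose equations for \<open>X\<close> as a generalised inverse of the real matrix \<open>M\<close>.\<close>

definition is_moore_penrose :: "real^'n^'m \<Rightarrow> real^'m^'n \<Rightarrow> bool" where
  "is_moore_penrose M X \<longleftrightarrow>
     M ** X ** M = M \<and>
     X ** M ** X = X \<and>
     transpose (M ** X) = M ** X \<and>
     transpose (X ** M) = X ** M"

definition moore_penrose :: "real^'n^'m \<Rightarrow> real^'m^'n" where
  "moore_penrose M = (THE X. is_moore_penrose M X)"

text \<open>
  For nonempty sets, \<open>setdist S T\<close> is the infimum of the distances between points of \<open>S\<close> and
  points of \<open>T\<close>; a best approximation pair attains it, so that it is then a minimum.
  If the direction spaces of two linear varieties share a nonzero vector, such pairs are not unique.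
\<close>

definition best_approximation_pair :: "(real^'m) set \<Rightarrow> (real^'m) set \<Rightarrow> real^'m \<Rightarrow> real^'m \<Rightarrow> bool" where
  "best_approximation_pair S T x y \<longleftrightarrow> x \<in> S \<and> y \<in> T \<and> norm (x - y) = setdist S T"

text \<open>
  For two linear varieties in parametric form, \<open>setdist\<close> is the Euclidean distance written in
  terms of the parameters.
\<close>

lemma setdist_linear_varieties:
  fixes b c :: "real^'m" and B :: "real^'l1^'m" and C :: "real^'l2^'m"
  shows "setdist {b + B *v u | u. True} {c - C *v v | v. True}
       = (INF (u, v). norm (b + B *v u - c + C *v v))"
proof -
  have d: "dist (b + B *v u) (c - C *v v) = norm (b + B *v u - c + C *v v)" for u v
    by (simp add: dist_norm algebra_simps)
  have "{dist x y |x y. x \<in> {b + B *v u | u. True} \<and> y \<in> {c - C *v v | v. True}}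
      = {dist (b + B *v u) (c - C *v v) | u v. True}"
    by blast
  also have "\<dots> = range (\<lambda>(u, v). norm (b + B *v u - c + C *v v))"
    unfolding d by auto
  finally show ?thesis
    by (auto simp: setdist_def)
qed

end

theory Submission
  imports Defs
begin

text \<open>
  Put \<open>d = c - b\<close>. Since \<open>C = G + B B\<^sup>\<dagger> C\<close> and \<open>I - G\<^sup>\<dagger> G\<close> is the orthogonal projection onto the
  kernel of \<open>G\<close>, one has \<open>C H\<^sup>T = B H H\<^sup>T\<close>, so the factor \<open>(I + H H\<^sup>T)\<^sup>-\<^sup>1\<close> cancels and
  \<open>B u + C v = B B\<^sup>\<dagger> d + G G\<^sup>\<dagger> d\<close>. The columns of \<open>G\<close> are orthogonal to those of \<open>B\<close>, so this is the
  orthogonal projection of \<open>d\<close> onto the span of the columns of \<open>B\<close> and \<open>C\<close>. Optimality follows by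
  Pythagoras, and uniqueness from the equality case.
\<close>

section \<open>Adjoints and solvability of the normal equations\<close>

declare transpose_matrix_vector [simp del]

lemma inner_matrix_vector_left:
  fixes A :: "real^'n^'m"
  shows "(A *v x) \<bullet> y = x \<bullet> (transpose A *v y)"
  by (metis dot_lmul_matrix inner_commute transpose_matrix_vector)

lemma transpose_matrix_vector_eq_0_iff:
  fixes A :: "real^'n^'m"
  shows "transpose A *v y = 0 \<longleftrightarrow> (\<forall>x. (A *v x) \<bullet> y = 0)"
  by (metis inner_eq_zero_iff inner_matrix_vector_left inner_zero_right)

text \<open>Split \<open>y\<close> orthogonally along the range of \<open>M\<close>: the component
  in the range supplies \<open>x\<close>, and \<open>transpose M\<close> annihilates the
  rest.\<close>

lemma normal_equation_solvable:
  fixes M :: "real^'n^'m"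
  shows "\<exists>x. transpose M *v (M *v x) = transpose M *v y"
proof -
  obtain z w where z: "z \<in> span (range ((*v) M))"
    and w: "\<And>t. t \<in> span (range ((*v) M)) \<Longrightarrow> orthogonal w t" and y: "y = z + w"
    by (rule orthogonal_subspace_decomp_exists) blast
  have "subspace (range ((*v) M))"
    by (simp add: linear_subspace_image)
  then obtain x where x: "z = M *v x"
    using z by (auto simp: span_eq_iff[THEN iffD2])
  have "transpose M *v w = 0"
    using w[OF span_base, OF rangeI]
    by (simp add: transpose_matrix_vector_eq_0_iff orthogonal_def inner_commute)
  then have "transpose M *v (M *v x) = transpose M *v y"
    by (simp add: x y matrix_vector_right_distrib)
  then show ?thesis ..
qed

text \<open>Solutions of the normal equation for the standard basis vectors are assembled as the
  columns of \<open>W\<close>.\<close>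

lemma normal_matrix_equation_solvable:
  fixes M :: "real^'n^'m"
  obtains W where "transpose M ** M ** W = transpose M"
proof -
  obtain f where f: "\<And>y. transpose M *v (M *v f y) = transpose M *v y"
    using normal_equation_solvable[of M] by metis
  define W where "W = (\<chi> i j. f (axis j 1) $ i)"
  have W: "W *v axis j 1 = f (axis j 1)" for j
    by (simp add: matrix_vector_mult_basis W_def column_def vec_eq_iff)
  have "column j (transpose M ** M ** W) = column j (transpose M)" for j
    by (metis W f matrix_vector_mul_assoc matrix_vector_mult_basis)
  then have "transpose M ** M ** W = transpose M"
    by (simp add: vec_eq_iff column_def)
  then show thesis ..
qed

section \<open>Existence and uniqueness of the Moore-Penrose inverse\<close>

lemma ex_least_squares_inverse:
  fixes M :: "real^'n^'m"
  obtains W where "M ** W ** M = M" "transpose (M ** W) = M ** W"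
proof -
  obtain W where W: "transpose M ** M ** W = transpose M"
    by (rule normal_matrix_equation_solvable)
  have T: "transpose W ** transpose M ** M = M"
    using arg_cong[OF W, of transpose] by (simp add: matrix_transpose_mul matrix_mul_assoc)
  \<comment> \<open>This exhibits \<open>M ** W\<close> as its own transpose.\<close>
  have "M ** W = transpose W ** transpose M ** M ** W"
    by (simp add: T)
  also have "\<dots> = transpose W ** transpose M"
    by (metis W matrix_mul_assoc)
  finally have MW: "M ** W = transpose W ** transpose M" .
  show thesis
    by (rule that[of W]) (simp_all add: MW T matrix_transpose_mul)
qed

text \<open>Urquhart's construction: if \<open>W\<close> makes \<open>M ** W\<close> symmetric,
  \<open>N\<close> makes \<open>N ** M\<close> symmetric, and both satisfy the first Penrose
  equation, then \<open>N ** M ** W\<close> satisfies all four.\<close>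

lemma ex_moore_penrose:
  fixes M :: "real^'n^'m"
  shows "\<exists>X. is_moore_penrose M X"
proof -
  obtain W where W: "M ** W ** M = M" "transpose (M ** W) = M ** W"
    by (rule ex_least_squares_inverse)
  \<comment> \<open>Transposing a least-squares inverse of \<open>transpose M\<close> moves the
    symmetry to the other product, \<open>N ** M\<close>.\<close>
  obtain N' where N': "transpose M ** N' ** transpose M = transpose M"
      "transpose (transpose M ** N') = transpose M ** N'"
    by (rule ex_least_squares_inverse)
  define N where "N = transpose N'"
  have N: "M ** N ** M = M" "transpose (N ** M) = N ** M"
    using arg_cong[OF N'(1), of transpose] N'(2)
    by (simp_all only: N_def matrix_transpose_mul matrix_mul_assoc transpose_transpose)
  have MX: "M ** (N ** M ** W) = M ** W"
    by (metis N(1) matrix_mul_assoc)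
  have XM: "N ** M ** W ** M = N ** M"
    by (metis W(1) matrix_mul_assoc)
  have "N ** M ** W ** M ** (N ** M ** W) = N ** M ** W"
    by (metis MX XM matrix_mul_assoc)
  then have "is_moore_penrose M (N ** M ** W)"
    by (simp add: is_moore_penrose_def MX XM W N)
  then show ?thesis ..
qed

text \<open>Transposing the symmetric product \<open>M ** Y ** M ** X\<close> swaps its two
  projections and leaves \<open>M ** Y\<close>, so \<open>M ** X = M ** Y\<close>; dually
  \<open>X ** M = Y ** M\<close>. Then \<open>X = Y ** M ** X = Y ** M ** Y = Y\<close>.\<close>

lemma moore_penrose_unique:
  fixes M :: "real^'n^'m"
  assumes X: "is_moore_penrose M X" and Y: "is_moore_penrose M Y"
  shows "X = Y"
proof -
  have "M ** X = transpose (M ** Y ** M ** X)"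
    using X Y by (simp add: is_moore_penrose_def)
  also have "\<dots> = transpose (M ** X) ** transpose (M ** Y)"
    by (metis matrix_mul_assoc matrix_transpose_mul)
  also have "\<dots> = M ** Y"
    using X Y by (simp add: is_moore_penrose_def matrix_mul_assoc)
  finally have MX: "M ** X = M ** Y" .
  have "X ** M = transpose (X ** (M ** Y ** M))"
    using X Y by (simp add: is_moore_penrose_def)
  also have "\<dots> = transpose (Y ** M) ** transpose (X ** M)"
    by (metis matrix_mul_assoc matrix_transpose_mul)
  also have "\<dots> = Y ** (M ** X ** M)"
    using X Y by (metis is_moore_penrose_def matrix_mul_assoc)
  also have "\<dots> = Y ** M"
    using X by (simp add: is_moore_penrose_def)
  finally have XM: "X ** M = Y ** M" .
  have "X = Y ** M ** X"
    using X XM by (simp add: is_moore_penrose_def)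
  also have "\<dots> = Y"
    using Y MX by (metis is_moore_penrose_def matrix_mul_assoc)
  finally show ?thesis .
qed

lemma is_moore_penrose_moore_penrose: "is_moore_penrose M (moore_penrose M)"
  unfolding moore_penrose_def
  using ex_moore_penrose moore_penrose_unique by (metis theI)

lemmas moore_penrose_equations =
  is_moore_penrose_moore_penrose[unfolded is_moore_penrose_def, THEN conjunct1]
  is_moore_penrose_moore_penrose[unfolded is_moore_penrose_def, THEN conjunct2, THEN conjunct1]
  is_moore_penrose_moore_penrose[unfolded is_moore_penrose_def, THEN conjunct2, THEN conjunct2,
    THEN conjunct1]
  is_moore_penrose_moore_penrose[unfolded is_moore_penrose_def, THEN conjunct2, THEN conjunct2,
    THEN conjunct2]

lemma transpose_mult_mult_moore_penrose:
  "transpose M ** (M ** moore_penrose M) = transpose M"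
  by (metis matrix_transpose_mul moore_penrose_equations(1,3))

section \<open>Invertibility of \<open>mat 1 + H ** transpose H\<close>\<close>

lemma invertible_mat_1_plus_mult_transpose:
  fixes H :: "real^'n^'m"
  shows "invertible (mat 1 + H ** transpose H)"
proof -
  have "x = 0" if x: "(mat 1 + H ** transpose H) *v x = 0" for x
  proof -
    \<comment> \<open>The quadratic form is a sum of two squares, so the kernel is trivial.\<close>
    have "x \<bullet> x + (transpose H *v x) \<bullet> (transpose H *v x) = x \<bullet> ((mat 1 + H ** transpose H) *v x)"
      by (simp add: inner_matrix_vector_left matrix_vector_mult_add_rdistrib inner_add_right
          matrix_vector_mul_assoc)
    then show ?thesis
      by (metis x add_nonneg_eq_0_iff inner_eq_zero_iff inner_ge_zero inner_zero_right)
  qed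
  then show ?thesis
    by (simp add: invertible_left_inverse matrix_left_invertible_ker)
qed

lemma matrix_inv_right_vector:
  fixes A :: "real^'n^'n"
  assumes "invertible A"
  shows "A *v (matrix_inv A *v x) = x"
proof -
  have "A ** matrix_inv A = mat 1"
    using someI_ex[OF assms[unfolded invertible_def]] by (simp add: matrix_inv_def)
  then show ?thesis
    by (simp add: matrix_vector_mul_assoc)
qed

section \<open>The block formula and its orthogonal residual\<close>

lemma matrix_vector_mult_moore_penrose_block:
  fixes B :: "real^'l1^'m" and C :: "real^'l2^'m" and d :: "real^'m"
  assumes G: "G = (mat 1 - B ** moore_penrose B) ** C"
    and H: "H = moore_penrose B ** C ** (mat 1 - moore_penrose G ** G)"
    and u: "u = (matrix_inv (mat 1 + H ** transpose H)
                 ** (moore_penrose B - moore_penrose B ** C ** moore_penrose G)) *v d"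
    and v: "v = (transpose H ** matrix_inv (mat 1 + H ** transpose H)
                 ** (moore_penrose B - moore_penrose B ** C ** moore_penrose G)
                 + moore_penrose G) *v d"
  shows "B *v u + C *v v = B *v (moore_penrose B *v d) + G *v (moore_penrose G *v d)"
proof -
  define R where "R = mat 1 - moore_penrose G ** G"
  have C: "C *v y = G *v y + B *v (moore_penrose B *v (C *v y))" for y
    by (simp add: G matrix_vector_mul_assoc[symmetric] matrix_vector_mult_diff_rdistrib)
  have R: "R *v y = y - moore_penrose G *v (G *v y)" for y
    by (simp add: R_def matrix_vector_mul_assoc matrix_vector_mult_diff_rdistrib)
  have GR: "G *v (R *v y) = 0" for y
    by (simp add: R matrix_vector_mult_diff_distrib matrix_vector_mul_assoc matrix_mul_assoc
        moore_penrose_equations)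
  have RR: "R *v (R *v y) = R *v y" for y
    using R[of "R *v y"] by (simp add: GR)
  have RT: "transpose R = R"
    using moore_penrose_equations(4)[of G] by (simp add: R_def transpose_def vec_eq_iff mat_def)
  have HT: "transpose H *v x = R *v (transpose (moore_penrose B ** C) *v x)" for x
    by (simp add: H R_def[symmetric] RT matrix_transpose_mul matrix_vector_mul_assoc matrix_mul_assoc)
  \<comment> \<open>Values of \<open>transpose H\<close> lie in the range of \<open>R\<close>, where
    \<open>G\<close> vanishes, so only the \<open>B\<close> part of \<open>C\<close> survives;
    idempotence of \<open>R\<close> turns that part into \<open>H\<close>.\<close>
  have CH: "C *v (transpose H *v x) = B *v (H *v (transpose H *v x))" for x
    using C[of "transpose H *v x"]
    by (simp add: HT GR) (simp add: H R_def[symmetric] RR matrix_vector_mul_assoc[symmetric])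
  \<comment> \<open>The common factor of both blocks: \<open>u\<close> solves
    \<open>(mat 1 + H ** transpose H) *v u = w\<close>, and \<open>v\<close> is expressed through
    \<open>u\<close>.\<close>
  define w where "w = moore_penrose B *v d - moore_penrose B *v (C *v (moore_penrose G *v d))"
  have u': "u = matrix_inv (mat 1 + H ** transpose H) *v w"
    by (simp add: u w_def matrix_vector_mul_assoc[symmetric] matrix_vector_mult_diff_rdistrib)
  have v': "v = transpose H *v u + moore_penrose G *v d"
    by (simp add: v u' w_def matrix_vector_mul_assoc[symmetric] matrix_vector_mult_diff_rdistrib
        matrix_vector_mult_add_rdistrib)
  have w: "u + H *v (transpose H *v u) = w"
    using matrix_inv_right_vector[OF invertible_mat_1_plus_mult_transpose[of H], of w]
    by (simp add: u'[symmetric] matrix_vector_mult_add_rdistrib matrix_vector_mul_assoc)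
  have "B *v u + C *v v = B *v (u + H *v (transpose H *v u)) + C *v (moore_penrose G *v d)"
    by (simp add: v' matrix_vector_right_distrib CH)
  \<comment> \<open>Splitting the outer \<open>C *v (moore_penrose G *v d)\<close> into its
    \<open>G\<close> and \<open>B\<close> parts cancels the subtracted term of
    \<open>w\<close>.\<close>
  also have "\<dots> = B *v (moore_penrose B *v d) + G *v (moore_penrose G *v d)"
    unfolding w w_def matrix_vector_mult_diff_distrib by (subst (2) C) simp
  finally show ?thesis .
qed

lemma moore_penrose_block_residual_orthogonal:
  fixes B :: "real^'l1^'m" and C :: "real^'l2^'m" and d :: "real^'m"
  defines "G \<equiv> (mat 1 - B ** moore_penrose B) ** C"
  defines "r \<equiv> d - (B *v (moore_penrose B *v d) + G *v (moore_penrose G *v d))"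
  shows "transpose B *v r = 0" and "transpose C *v r = 0"
proof -
  have proj: "transpose M *v (M *v (moore_penrose M *v x)) = transpose M *v x"
    for M :: "real^'k^'m" and x
    by (simp add: matrix_vector_mul_assoc transpose_mult_mult_moore_penrose)
  have G: "G *v y = C *v y - B *v (moore_penrose B *v (C *v y))" for y
    by (simp add: G_def matrix_vector_mul_assoc[symmetric] matrix_vector_mult_diff_rdistrib)
  \<comment> \<open>\<open>G *v y\<close> is what remains of \<open>C *v y\<close> after projection
    onto the range of \<open>B\<close>.\<close>
  have BG: "transpose B *v (G *v y) = 0" for y
    by (simp add: G matrix_vector_mult_diff_distrib proj)
  have GB: "transpose G *v (B *v x) = 0" for x
    using BG by (simp add: transpose_matrix_vector_eq_0_iff inner_commute)
  show B: "transpose B *v r = 0"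
    by (simp add: r_def matrix_vector_mult_diff_distrib matrix_vector_right_distrib proj BG)
  have Gr: "transpose G *v r = 0"
    by (simp add: r_def matrix_vector_mult_diff_distrib matrix_vector_right_distrib proj GB)
  \<comment> \<open>Each \<open>C *v y\<close> is a sum of vectors from the ranges of
    \<open>G\<close> and \<open>B\<close>, both already orthogonal to \<open>r\<close>.\<close>
  have "(C *v y) \<bullet> r = 0" for y
  proof -
    have "(C *v y) \<bullet> r = (G *v y) \<bullet> r + (B *v (moore_penrose B *v (C *v y))) \<bullet> r"
      by (simp add: G inner_diff_left)
    then show ?thesis
      by (simp only: inner_matrix_vector_left B Gr inner_zero_right add_0)
  qed
  then show "transpose C *v r = 0"
    by (simp add: transpose_matrix_vector_eq_0_iff)
qed

section \<open>From the normal equations to optimality and uniqueness\<close>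

lemma best_approximation_pair_normal_equations:
  fixes b c :: "real^'m" and B :: "real^'l1^'m" and C :: "real^'l2^'m"
  assumes Vb: "Vb = {b + B *v x | x. True}"
    and Vc: "Vc = {c - C *v y | y. True}"
    and B: "transpose B *v (c - b - (B *v u + C *v v)) = 0"
    and C: "transpose C *v (c - b - (B *v u + C *v v)) = 0"
  shows "best_approximation_pair Vb Vc (b + B *v u) (c - C *v v)"
    and "\<lbrakk>range ((*v) B) \<inter> range ((*v) C) = {0}; best_approximation_pair Vb Vc p q\<rbrakk>
      \<Longrightarrow> p = b + B *v u \<and> q = c - C *v v"
proof -
  define r where "r = c - b - (B *v u + C *v v)"
  \<comment> \<open>Any difference of points is \<open>- r\<close> plus a vector in the joint column
    span, to which \<open>r\<close> is orthogonal.\<close>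
  have pyth: "(norm ((b + B *v x) - (c - C *v y)))\<^sup>2
      = (norm r)\<^sup>2 + (norm (B *v (x - u) + C *v (y - v)))\<^sup>2" for x y
  proof -
    have "(B *v (x - u) + C *v (y - v)) \<bullet> r = 0"
      using B C by (simp add: inner_add_left inner_matrix_vector_left r_def[symmetric])
    moreover have "(b + B *v x) - (c - C *v y) = (B *v (x - u) + C *v (y - v)) - r"
      by (simp add: r_def matrix_vector_mult_diff_distrib)
    ultimately show ?thesis
      by (simp add: power2_norm_eq_inner inner_diff inner_commute)
  qed
  have rn: "norm ((b + B *v u) - (c - C *v v)) = norm r"
    using pyth[of u v] by simp
  have le: "norm r \<le> norm ((b + B *v x) - (c - C *v y))" for x y
    by (rule power2_le_imp_le) (simp_all add: pyth)
  have sd: "setdist Vb Vc = norm r"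
    unfolding rn[symmetric] dist_norm[symmetric]
    by (rule setdist_unique) (use le in \<open>auto simp: Vb Vc rn dist_norm\<close>)
  show "best_approximation_pair Vb Vc (b + B *v u) (c - C *v v)"
    unfolding best_approximation_pair_def sd rn by (auto simp: Vb Vc)
  assume int: "range ((*v) B) \<inter> range ((*v) C) = {0}" and "best_approximation_pair Vb Vc p q"
  then obtain x y where p: "p = b + B *v x" and q: "q = c - C *v y" and "norm (p - q) = norm r"
    unfolding best_approximation_pair_def sd by (auto simp: Vb Vc)
  \<comment> \<open>Equal distance kills the second Pythagorean term. This fixes only
    \<open>p - q\<close>; trivial intersection of the ranges then fixes each point.\<close>
  then have "B *v (x - u) + C *v (y - v) = 0"
    using pyth[of x y] by simp
  then have eq: "B *v (x - u) = C *v (v - y)"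
    by (simp add: matrix_vector_mult_diff_distrib algebra_simps)
  then have "B *v (x - u) = 0"
    using int by blast
  with eq show "p = b + B *v u \<and> q = c - C *v v"
    by (simp add: p q matrix_vector_mult_diff_distrib)
qed

theorem corollary2p3:
  fixes b c :: "real^'m" and B :: "real^'l1^'m" and C :: "real^'l2^'m"
    and G :: "real^'l2^'m" and H :: "real^'l2^'l1"
    and Vb Vc :: "(real^'m) set"
    and u :: "real^'l1" and v :: "real^'l2"
  assumes Vb: "Vb = {b + B *v x | x. True}"
    and Vc: "Vc = {c - C *v y | y. True}"
    and non_intersecting: "Vb \<inter> Vc = {}"
    and non_parallel: "\<not> affine_parallel Vb Vc"
    and G: "G = (mat 1 - B ** moore_penrose B) ** C"
    and H: "H = moore_penrose B ** C ** (mat 1 - moore_penrose G ** G)"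
    and u: "u = (matrix_inv (mat 1 + H ** transpose H)
                 ** (moore_penrose B - moore_penrose B ** C ** moore_penrose G)) *v (c - b)"
    and v: "v = (transpose H ** matrix_inv (mat 1 + H ** transpose H)
                 ** (moore_penrose B - moore_penrose B ** C ** moore_penrose G)
                 + moore_penrose G) *v (c - b)"
  shows "best_approximation_pair Vb Vc (b + B *v u) (c - C *v v) \<and>
    (range (\<lambda>x. B *v x) \<inter> range (\<lambda>y. C *v y) = {0} \<longrightarrow>
      (\<forall>p q. best_approximation_pair Vb Vc p q \<longrightarrow> p = b + B *v u \<and> q = c - C *v v))"
proof -
  \<comment> \<open>The block formula rewrites the residual into the form known to be orthogonal to
    both column spaces.\<close>
  have res: "c - b - (B *v u + C *v v)
      = c - b - (B *v (moore_penrose B *v (c - b)) + G *v (moore_penrose G *v (c - b)))"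
    by (simp only: matrix_vector_mult_moore_penrose_block[OF G H u v])
  have "transpose B *v (c - b - (B *v u + C *v v)) = 0"
    and "transpose C *v (c - b - (B *v u + C *v v)) = 0"
    unfolding res G by (rule moore_penrose_block_residual_orthogonal)+
  note best = best_approximation_pair_normal_equations[OF Vb Vc this]
  show ?thesis
    using best by blast
qed

end
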